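(* Let $G$ and $J$ be graphs. If there exists a set $S$ with $S \not\subseteq V(G)$ and $S \not\subseteq V(J)$ such that $S$ is a minimum small common neighbourhood set of $G \vee J$, then $c_H(G \vee J) \leq \Upsilon(G \vee J)$.
   Context: The join $G \vee J$ has vertex set $V(G) \cup V(J)$ (disjoint union) and edge set $E(G) \cup E(J) \cup \{uv : u \in V(G), v \in V(J)\}$. For a graph $H$, $N(v)$ is the open neighbourhood of $v$; a non-empty set $S \subseteq V(H)$ is a small common neighbourhood set of $H$ if $\left|\bigcap_{v\in S} N(v)\right| \le |S|$; $\Upsilon(H)$ is the minimum cardinality of such a set, and a minimum small common neighbourhood set is one of cardinality $\Upsilon(H)$. Hyperopic Cops and Robber on $H$ (each vertex considered to carry a loop, so a player may stay put): the cops first occupy a multiset of vertices, then the robber chooses a vertex. In each round, each cop moves to an adjacent vertex or stays, then the robber moves to an adjacent vertex or stays. The robber always sees all cops. The cops see the robber's position except when the robber's vertex is adjacent to every vertex occupied by a cop, in which case the robber is invisible. The robber is captured when a cop occupies the robber's vertex. $c_H(H)$ is the minimum number of cops that can guarantee capture in finitely many moves. *)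

theory Defs
  imports "Graph_Theory.Pair_Digraph"
begin

text \<open>
  A finite simple graph is a symmetric loop-free finite digraph, \<^term>\<open>pair_graph\<close>: an edge
  \<open>uv\<close> is represented by the two arcs \<open>(u, v)\<close> and \<open>(v, u)\<close>.
\<close>

definition join :: "'a pair_pre_digraph \<Rightarrow> 'b pair_pre_digraph \<Rightarrow> ('a + 'b) pair_pre_digraph" where
  "join G J =
    \<lparr> pverts = Inl ` pverts G \<union> Inr ` pverts J,
      parcs = map_prod Inl Inl ` parcs G \<union> map_prod Inr Inr ` parcs J
        \<union> Inl ` pverts G \<times> Inr ` pverts J \<union> Inr ` pverts J \<times> Inl ` pverts G \<rparr>"

lemma pair_graph_join:
  assumes "pair_graph G" "pair_graph J"
  shows "pair_graph (join G J)"
proof -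
  interpret G: pair_graph G by fact
  interpret J: pair_graph J by fact
  have sG: "sym (parcs G)" using G.pair_sym_arcs by (simp add: symmetric_def)
  have sJ: "sym (parcs J)" using J.pair_sym_arcs by (simp add: symmetric_def)
  have "sym (parcs (join G J))"
    using sG sJ by (force simp: sym_def join_def)
  then show ?thesis
    by unfold_locales
      (auto simp: join_def symmetric_def G.pair_finite_verts G.pair_finite_arcs
        J.pair_finite_verts J.pair_finite_arcs
        dest: G.in_arcsD1 G.in_arcsD2 J.in_arcsD1 J.in_arcsD2 G.no_loops' J.no_loops')
qed


definition open_nbhd :: "'v pair_pre_digraph \<Rightarrow> 'v \<Rightarrow> 'v set" where
  "open_nbhd H v = {w. (v, w) \<in> parcs H}"

definition small_common_nbhd_set :: "'v pair_pre_digraph \<Rightarrow> 'v set \<Rightarrow> bool" where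
  "small_common_nbhd_set H S \<longleftrightarrow>
    S \<noteq> {} \<and> S \<subseteq> pverts H \<and> card (\<Inter>v\<in>S. open_nbhd H v) \<le> card S"

definition Upsilon :: "'v pair_pre_digraph \<Rightarrow> nat" where
  "Upsilon H = (LEAST n. \<exists>S. small_common_nbhd_set H S \<and> card S = n)"

definition min_small_common_nbhd_set :: "'v pair_pre_digraph \<Rightarrow> 'v set \<Rightarrow> bool" where
  "min_small_common_nbhd_set H S \<longleftrightarrow> small_common_nbhd_set H S \<and> card S = Upsilon H"

text \<open>The minimum defining \<^term>\<open>Upsilon H\<close> is over a non-empty set:\<close>

lemma small_common_nbhd_set_pverts:
  assumes "pair_graph H" "pverts H \<noteq> {}"
  shows "small_common_nbhd_set H (pverts H)"
proof -
  interpret pair_graph H by fact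
  have "(\<Inter>v\<in>pverts H. open_nbhd H v) = {}"
    using assms(2) by (auto simp: open_nbhd_def dest: in_arcsD2 no_loops')
  then show ?thesis
    using assms(2) by (simp add: small_common_nbhd_set_def)
qed


text \<open>
  Hyperopic Cops and Robber. The cops' vertices form a list, whose \<open>i\<close>-th entry is the vertex of
  the \<open>i\<close>-th cop; repetitions are allowed, so that a list of length \<open>k\<close> is a multiset of \<open>k\<close>
  vertices together with a naming of the cops.
\<close>

definition legal_move :: "'v pair_pre_digraph \<Rightarrow> 'v \<Rightarrow> 'v \<Rightarrow> bool" where
  "legal_move H u v \<longleftrightarrow> u = v \<or> (u, v) \<in> parcs H"

text \<open>
  What the cops at \<open>cs\<close> see of a robber at \<open>x\<close>. Adjacency is that of the simple graph; the loops
  only serve to allow staying put. Reading adjacency with loops here would change the observation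
  only when \<open>x\<close> is a vertex of \<open>cs\<close>, that is, when the robber has been captured.
\<close>

definition observation :: "'v pair_pre_digraph \<Rightarrow> 'v list \<Rightarrow> 'v \<Rightarrow> 'v option" where
  "observation H cs x = (if \<forall>c\<in>set cs. (c, x) \<in> parcs H then None else Some x)"

text \<open>
  A strategy of the cops is an initial placement \<open>c0\<close> and a function \<open>\<sigma>\<close> giving their next
  vertices from the sequence of all observations so far. The cops observe after the robber's
  placement and after each single move, be it theirs or the robber's.
  Their own previous vertices are determined by \<open>c0\<close>, \<open>\<sigma>\<close> and the observations.
  The walk \<open>r\<close> of the robber gives his vertex \<open>r n\<close> at the end of round \<open>n\<close>, where round \<open>0\<close>
  is the placement.
\<close>

fun observations ::
  "'v pair_pre_digraph \<Rightarrow> 'v list \<Rightarrow> ('v option list \<Rightarrow> 'v list) \<Rightarrow> (nat \<Rightarrow> 'v) \<Rightarrow> nat \<Rightarrow> 'v option list"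
where
  "observations H c0 \<sigma> r 0 = [observation H c0 (r 0)]"
| "observations H c0 \<sigma> r (Suc n) =
    (let obs = observations H c0 \<sigma> r n; cs = \<sigma> obs
     in obs @ [observation H cs (r n), observation H cs (r (Suc n))])"

fun cops_at ::
  "'v pair_pre_digraph \<Rightarrow> 'v list \<Rightarrow> ('v option list \<Rightarrow> 'v list) \<Rightarrow> (nat \<Rightarrow> 'v) \<Rightarrow> nat \<Rightarrow> 'v list"
where
  "cops_at H c0 \<sigma> r 0 = c0"
| "cops_at H c0 \<sigma> r (Suc n) = \<sigma> (observations H c0 \<sigma> r n)"

definition robber_walk :: "'v pair_pre_digraph \<Rightarrow> (nat \<Rightarrow> 'v) \<Rightarrow> bool" where
  "robber_walk H r \<longleftrightarrow> r 0 \<in> pverts H \<and> (\<forall>n. legal_move H (r n) (r (Suc n)))"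

text \<open>
  Play is formally continued after a capture, which is no restriction: a robber on the vertex of
  a cop is visible, so that the cops notice the capture and may stay put from then on.
\<close>

definition cop_strategy ::
  "'v pair_pre_digraph \<Rightarrow> nat \<Rightarrow> 'v list \<Rightarrow> ('v option list \<Rightarrow> 'v list) \<Rightarrow> bool" where
  "cop_strategy H k c0 \<sigma> \<longleftrightarrow> length c0 = k \<and> set c0 \<subseteq> pverts H \<and>
    (\<forall>r. robber_walk H r \<longrightarrow>
      (\<forall>n. list_all2 (legal_move H) (cops_at H c0 \<sigma> r n) (cops_at H c0 \<sigma> r (Suc n))))"

text \<open>
  The robber is captured if he shares a vertex with a cop at the end of some round \<open>n\<close> or
  between the two moves of round \<open>n + 1\<close>.
\<close>

definition captured ::
  "'v pair_pre_digraph \<Rightarrow> 'v list \<Rightarrow> ('v option list \<Rightarrow> 'v list) \<Rightarrow> (nat \<Rightarrow> 'v) \<Rightarrow> bool" where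
  "captured H c0 \<sigma> r \<longleftrightarrow>
    (\<exists>n. r n \<in> set (cops_at H c0 \<sigma> r n) \<or> r n \<in> set (cops_at H c0 \<sigma> r (Suc n)))"

text \<open>
  Quantifying over all walks of the robber amounts to quantifying over all his strategies, with
  full information about the cops, since the cops play deterministically.
\<close>

definition cops_win :: "'v pair_pre_digraph \<Rightarrow> nat \<Rightarrow> bool" where
  "cops_win H k \<longleftrightarrow>
    (\<exists>c0 \<sigma>. cop_strategy H k c0 \<sigma> \<and> (\<forall>r. robber_walk H r \<longrightarrow> captured H c0 \<sigma> r))"

definition hyperopic_cop_number :: "'v pair_pre_digraph \<Rightarrow> nat" where
  "hyperopic_cop_number H = (LEAST k. cops_win H k)"

text \<open>Again the minimum is over a non-empty set:\<close>

lemma cops_win_card_pverts: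
  assumes "finite (pverts H)"
  shows "cops_win H (card (pverts H))"
proof -
  obtain c0 where c0: "set c0 = pverts H" "distinct c0"
    using finite_distinct_list[OF assms] by blast
  define \<sigma> where "\<sigma> = (\<lambda>_ :: 'a option list. c0)"
  have at: "cops_at H c0 \<sigma> r n = c0" for r n
    by (cases n) (simp_all add: \<sigma>_def)
  have "cop_strategy H (card (pverts H)) c0 \<sigma>"
    using c0 distinct_card[OF c0(2)]
    by (auto simp: cop_strategy_def at legal_move_def list.rel_refl simp del: cops_at.simps)
  moreover have "captured H c0 \<sigma> r" if "robber_walk H r" for r
    using that c0(1) by (auto simp: captured_def at robber_walk_def simp del: cops_at.simps)
  ultimately show ?thesis
    unfolding cops_win_def by blast
qed

end

theory Submission
  imports Defs
begin

text \<open>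
  Place one cop on each vertex of \<open>S\<close>. An invisible robber is on a common neighbour of \<open>S\<close>; there
  are at most as many of these as cops, and each of them can be reached by each cop, so that the
  cops can occupy all of them at once. A visible robber is adjacent to the cops on the other side
  of the join. Either way he is captured by the first move of the cops.
\<close>

lemma legal_move_refl [simp]: "legal_move H v v"
  by (simp add: legal_move_def)

text \<open>Lets a strategy recover what was seen at the placement at any later time.\<close>

lemma hd_observations: "hd (observations H c0 \<sigma> r n) = observation H c0 (r 0)"
proof -
  have "observations H c0 \<sigma> r n \<noteq> [] \<and> hd (observations H c0 \<sigma> r n) = observation H c0 (r 0)"
    by (induction n) (auto simp: Let_def)
  then show ?thesis ..
qed

text \<open>The cops move first after the placement, so the robber is still on \<open>r 0\<close>
  when they answer what they saw of him. The answer \<open>ds\<close> is chosen before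
  \<open>x\<close>: it has to serve all vertices that give the same observation.\<close>

lemma cops_win_in_one_move:
  assumes "set c0 \<subseteq> pverts H"
    and response: "\<And>ob. \<exists>ds. list_all2 (legal_move H) c0 ds \<and>
      (\<forall>x\<in>pverts H. observation H c0 x = ob \<longrightarrow> x \<in> set c0 \<union> set ds)"
  shows "cops_win H (length c0)"
proof -
  obtain f where f: "\<And>ob. list_all2 (legal_move H) c0 (f ob)"
    and catch: "\<And>x. x \<in> pverts H \<Longrightarrow> x \<in> set c0 \<union> set (f (observation H c0 x))"
    using response by metis
  define \<sigma> where "\<sigma> obs = f (hd obs)" for obs
  have at: "cops_at H c0 \<sigma> r (Suc n) = f (observation H c0 (r 0))" for r n
    by (simp add: \<sigma>_def hd_observations)
  \<comment> \<open>Only the first move changes anything: \<open>\<sigma>\<close> reads just the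
    head of its input, so from round 1 on the cops stay put.\<close>
  have "list_all2 (legal_move H) (cops_at H c0 \<sigma> r n) (cops_at H c0 \<sigma> r (Suc n))" for r n
    by (cases n) (simp_all only: at cops_at.simps(1) f list.rel_refl legal_move_refl)
  then have "cop_strategy H (length c0) c0 \<sigma>"
    using assms(1) unfolding cop_strategy_def by blast
  moreover have "captured H c0 \<sigma> r" if "robber_walk H r" for r
  proof -
    have "r 0 \<in> set (cops_at H c0 \<sigma> r 0) \<or> r 0 \<in> set (cops_at H c0 \<sigma> r (Suc 0))"
      using catch[of "r 0"] that unfolding at by (simp add: robber_walk_def)
    then show ?thesis
      unfolding captured_def by blast
  qed
  ultimately show ?thesis
    unfolding cops_win_def by blast
qed

text \<open>The join will enter only through \<open>dominating\<close>, which gives every visible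
  robber a neighbouring cop.\<close>

lemma cops_win_small_common_nbhd_set:
  assumes "pair_graph H" and small: "small_common_nbhd_set H S"
    and dominating: "\<And>x. x \<in> pverts H \<Longrightarrow> \<exists>c\<in>S. (c, x) \<in> parcs H"
  shows "cops_win H (card S)"
proof -
  interpret pair_graph H by fact
  define C where "C = (\<Inter>v\<in>S. open_nbhd H v)"
  have S: "S \<noteq> {}" "S \<subseteq> pverts H" "card C \<le> card S"
    using small by (auto simp: small_common_nbhd_set_def C_def)
  have "finite S"
    using S(2) finite_subset pair_finite_verts by blast
  then obtain c0 where c0: "set c0 = S" "distinct c0"
    using finite_distinct_list by blast
  have len: "length c0 = card S"
    using c0 distinct_card by metis
  \<comment> \<open>An intersection over the empty set would be \<open>UNIV\<close>, hence the
    appeal to \<open>S \<noteq> {}\<close>.\<close>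
  have "C \<subseteq> pverts H"
    using S(1) by (auto simp: C_def open_nbhd_def dest: in_arcsD2)
  then have "finite C"
    using finite_subset pair_finite_verts by blast
  then obtain xs where xs: "set xs = C" "distinct xs"
    using finite_distinct_list by blast
  have len_xs: "length xs \<le> length c0"
    using xs S(3) distinct_card len by metis
  have "cops_win H (length c0)"
  proof (rule cops_win_in_one_move)
    show "set c0 \<subseteq> pverts H"
      using c0 S by simp
    fix ob
    show "\<exists>ds. list_all2 (legal_move H) c0 ds \<and>
      (\<forall>x\<in>pverts H. observation H c0 x = ob \<longrightarrow> x \<in> set c0 \<union> set ds)"
    proof (cases ob)
      case None
      \<comment> \<open>The first \<open>length xs\<close> cops spread over \<open>C\<close>, one on
        each vertex, and the others stay.\<close>
      define ds where "ds = xs @ drop (length xs) c0"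
      have "legal_move H (c0 ! i) (xs ! i)" if "i < length xs" for i
      proof -
        have "c0 ! i \<in> S" "xs ! i \<in> C"
          using that len_xs c0 xs nth_mem by fastforce+
        then show ?thesis
          by (auto simp: C_def open_nbhd_def legal_move_def)
      qed
      then have "list_all2 (legal_move H) c0 ds"
        using len_xs by (auto simp: list_all2_conv_all_nth ds_def nth_append)
      moreover have "x \<in> set ds" if "observation H c0 x = ob" for x
        using that None xs c0
        by (auto simp: observation_def ds_def C_def open_nbhd_def split: if_splits)
      ultimately show ?thesis by blast
    next
      case (Some x)
      then have only: "y = x" if "observation H c0 y = ob" for y
        using that by (auto simp: observation_def split: if_splits)
      show ?thesis
      proof (cases "x \<in> pverts H")
        case True
        then obtain i where i: "i < length c0" "(c0 ! i, x) \<in> parcs H"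
          using dominating c0 by (metis in_set_conv_nth)
        have "list_all2 (legal_move H) c0 (c0[i := x])"
          using i by (auto simp: list_all2_conv_all_nth nth_list_update legal_move_def)
        moreover have "x \<in> set (c0[i := x])"
          using i(1) by (rule set_update_memI)
        ultimately show ?thesis
          using only by blast
      next
        \<comment> \<open>No vertex of \<open>H\<close> yields this observation, so any legal move
          will do; the cops stay.\<close>
        case False
        then show ?thesis
          using only list.rel_refl[of "legal_move H" c0] by auto
      qed
    qed
  qed
  then show ?thesis
    by (simp add: len)
qed

theorem theorem4p3:
  fixes G :: "'a pair_pre_digraph" and J :: "'b pair_pre_digraph"
  assumes "pair_graph G" and "pair_graph J"
    and "\<exists>S. min_small_common_nbhd_set (join G J) S \<and>
      \<not> S \<subseteq> Inl ` pverts G \<and> \<not> S \<subseteq> Inr ` pverts J"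
  shows "hyperopic_cop_number (join G J) \<le> Upsilon (join G J)"
proof -
  obtain S where S: "small_common_nbhd_set (join G J) S" "card S = Upsilon (join G J)"
    "\<not> S \<subseteq> Inl ` pverts G" "\<not> S \<subseteq> Inr ` pverts J"
    using assms(3) by (auto simp: min_small_common_nbhd_set_def)
  have "S \<subseteq> Inl ` pverts G \<union> Inr ` pverts J"
    using S(1) by (simp add: small_common_nbhd_set_def join_def)
  with S(3,4) obtain u v where uv: "Inl u \<in> S" "u \<in> pverts G" "Inr v \<in> S" "v \<in> pverts J"
    by blast
  \<comment> \<open>\<open>Inr v\<close> is adjacent to the whole copy of \<open>G\<close>, and
    \<open>Inl u\<close> to the whole copy of \<open>J\<close>.\<close>
  have "\<exists>c\<in>S. (c, x) \<in> parcs (join G J)" if "x \<in> pverts (join G J)" for x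
    using that uv by (cases x) (auto simp: join_def)
  then have "cops_win (join G J) (card S)"
    using cops_win_small_common_nbhd_set[OF pair_graph_join[OF assms(1,2)] S(1)] by blast
  then show ?thesis
    unfolding hyperopic_cop_number_def S(2) by (rule Least_le)
qed

end
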